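(* Let $d\in\mathbb{N}$, $d\ge1$, let $\lambda_1,\dots,\lambda_d>0$ be real numbers, and let $\mathbb{R}_+=(0,\infty)$. Define $g:\mathbb{R}_+\to\mathbb{R}_+$ by $$g(\beta):=\left(\frac{\sum_{i=1}^{d}\frac{1}{1+\beta\lambda_i}}{\sum_{i=1}^{d}\frac{\lambda_i}{1+\beta\lambda_i}}\right)^{1/2}.$$ Then, starting from any initial guess $\beta_0\in\mathbb{R}_+$, the iteration $\beta_{n+1}=g(\beta_n)$ converges to a unique fixed point $\beta_+\in\mathbb{R}_+$ of $g$; that is, $g$ has a unique fixed point $\beta_+\in\mathbb{R}_+$, and $\lim_{n\to\infty}g^n(\beta_0)=\beta_+$ for every $\beta_0\in\mathbb{R}_+$.
   Context: $g^n$ denotes the $n$-fold composition of $g$ with itself. In the paper, $\lambda_1,\dots,\lambda_d$ are the (positive) eigenvalues of $Q_1^{-1}Q_2$ for real symmetric positive definite $d\times d$ matrices $Q_1,Q_2$. The equation $\beta=g(\beta)$ with $\beta>0$ is a rewriting of $\sum_{i=1}^d\frac{1-\beta^2\lambda_i}{1+\beta\lambda_i}=0$, whose positive root is denoted $\beta_+$. *)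

theory Defs
  imports "HOL-Analysis.Analysis"
begin

(* Only the values lam 1, ..., lam d matter.  The map is used on the positive reals only;
   its values elsewhere are irrelevant. *)
definition g :: "nat \<Rightarrow> (nat \<Rightarrow> real) \<Rightarrow> real \<Rightarrow> real" where
  "g d lam \<beta> = sqrt ((\<Sum>i=1..d. 1 / (1 + \<beta> * lam i)) / (\<Sum>i=1..d. lam i / (1 + \<beta> * lam i)))"

end

theory Submission
  imports Defs
begin

text \<open>
  Write \<open>A(\<beta>) = \<Sum> 1 / (1 + \<beta> \<lambda>\<^sub>i)\<close> and \<open>B(\<beta>) = \<Sum> \<lambda>\<^sub>i / (1 + \<beta> \<lambda>\<^sub>i)\<close>, so that \<open>g = sqrt (A / B)\<close>.
  Two monotonicity facts together force convergence.

  \<^item> \<open>g(\<beta>)\<close> lies above, on or below \<open>\<beta>\<close> according to the sign of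
    \<open>A(\<beta>) - \<beta>\<^sup>2 B(\<beta>) = \<Sum> (1 - \<beta>\<^sup>2 \<lambda>\<^sub>i) / (1 + \<beta> \<lambda>\<^sub>i)\<close>.
    Each summand is strictly decreasing in \<open>\<beta>\<close>, is \<open>1\<close> at \<open>0\<close> and becomes negative, so this balance
    has exactly one positive zero \<open>\<beta>\<^sub>+\<close>; hence \<open>\<beta> < g(\<beta>)\<close> to the left of \<open>\<beta>\<^sub>+\<close> and \<open>g(\<beta>) < \<beta>\<close> to its
    right (lemmas \<open>balance_strict_decreasing\<close>, \<open>ex_balance_zero\<close>, \<open>less_g_iff\<close>, \<open>g_less_iff\<close>).

  \<^item> \<open>g\<close> is nondecreasing. Since \<open>A + \<beta> B = d\<close>, we have \<open>g\<^sup>2 = d / B - \<beta>\<close>, and the growth of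
    \<open>d / B\<close> outweighs that of \<open>\<beta>\<close> by Chebyshev's sum inequality (lemma \<open>g_mono\<close>).

  Monotonicity keeps the orbit of \<open>\<beta>\<^sub>0\<close> on the side of \<open>\<beta>\<^sub>+\<close> where it started, and there it moves
  monotonically towards \<open>\<beta>\<^sub>+\<close>. So it converges, by continuity to a fixed point, and there is only one
  (lemma \<open>monotone_iteration_tendsto\<close>).
\<close>

section \<open>Iterating a monotone map with an attracting fixed point\<close>

lemma tendsto_iterates_is_fixpoint:
  fixes f :: "real \<Rightarrow> real"
  assumes "(\<lambda>n. (f ^^ n) x) \<longlonglongrightarrow> L" and "isCont f L"
  shows "f L = L"
proof -
  have "(\<lambda>n. f ((f ^^ n) x)) \<longlonglongrightarrow> f L"
    using assms(2,1) by (rule isCont_tendsto_compose)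
  moreover have "(\<lambda>n. f ((f ^^ n) x)) \<longlonglongrightarrow> L"
    using LIMSEQ_Suc[OF assms(1)] by simp
  ultimately show ?thesis by (rule LIMSEQ_unique)
qed

lemma monotone_iteration_tendsto:
  fixes f :: "real \<Rightarrow> real"
  assumes cont: "\<And>x. x > 0 \<Longrightarrow> isCont f x"
    and mono: "\<And>x y. 0 < x \<Longrightarrow> x \<le> y \<Longrightarrow> f x \<le> f y"
    and p: "p > 0" "f p = p"
    and up: "\<And>x. 0 < x \<Longrightarrow> x < p \<Longrightarrow> x < f x"
    and down: "\<And>x. p < x \<Longrightarrow> f x < x"
    and x: "x > 0"
  shows "(\<lambda>n. (f ^^ n) x) \<longlonglongrightarrow> p"
proof (cases "x \<le> p")
  case True
  have bounds: "x \<le> (f ^^ n) x \<and> (f ^^ n) x \<le> p" for n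
  proof (induction n)
    case (Suc n)
    then have "(f ^^ n) x \<le> f ((f ^^ n) x)"
      using up[of "(f ^^ n) x"] x p by (cases "(f ^^ n) x = p") auto
    moreover have "f ((f ^^ n) x) \<le> f p"
      using Suc x by (intro mono) auto
    ultimately show ?case using Suc p by simp
  qed (use True in simp)
  have step: "(f ^^ n) x \<le> (f ^^ Suc n) x" for n
    using up[of "(f ^^ n) x"] bounds[of n] x p by (cases "(f ^^ n) x = p") auto
  then have "incseq (\<lambda>n. (f ^^ n) x)" by (intro incseq_SucI) auto
  then obtain L where L: "(\<lambda>n. (f ^^ n) x) \<longlonglongrightarrow> L"
    using incseq_convergent[of _ p] bounds by metis
  have "x \<le> L" "L \<le> p"
    using LIMSEQ_le_const[OF L] LIMSEQ_le_const2[OF L] bounds by blast+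
  moreover from this have "f L = L"
    using tendsto_iterates_is_fixpoint[OF L] cont x by auto
  ultimately have "L = p" using up[of L] x by fastforce
  with L show ?thesis by simp
next
  case False
  have bounds: "p \<le> (f ^^ n) x" for n
  proof (induction n)
    case (Suc n)
    then have "f p \<le> f ((f ^^ n) x)" using p by (intro mono) auto
    then show ?case using p by simp
  qed (use False in simp)
  have step: "(f ^^ Suc n) x \<le> (f ^^ n) x" for n
    using down[of "(f ^^ n) x"] bounds[of n] p by (cases "(f ^^ n) x = p") auto
  then have "decseq (\<lambda>n. (f ^^ n) x)" by (intro decseq_SucI) auto
  then obtain L where L: "(\<lambda>n. (f ^^ n) x) \<longlonglongrightarrow> L"
    using decseq_convergent[of _ p] bounds by metis
  have "p \<le> L"
    using LIMSEQ_le_const[OF L] bounds by blast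
  moreover from this have "f L = L"
    using tendsto_iterates_is_fixpoint[OF L] cont p by auto
  ultimately have "L = p" using down[of L] by fastforce
  with L show ?thesis by simp
qed

section \<open>Chebyshev's sum inequality for similarly ordered families\<close>

text \<open>
  The difference of the two sides is half the double sum of \<open>(x\<^sub>i - x\<^sub>j) (y\<^sub>i - y\<^sub>j)\<close>. In this form
  the families need not be sorted along the index set.
\<close>

lemma Chebyshev_sum_similarly_ordered:
  fixes x y :: "'a \<Rightarrow> real"
  assumes "\<And>i j. i \<in> I \<Longrightarrow> j \<in> I \<Longrightarrow> (x i - x j) * (y i - y j) \<ge> 0"
  shows "sum x I * sum y I \<le> real (card I) * (\<Sum>i\<in>I. x i * y i)"
proof -
  have "(\<Sum>i\<in>I. \<Sum>j\<in>I. (x i - x j) * (y i - y j)) =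
      (\<Sum>i\<in>I. \<Sum>j\<in>I. x i * y i) + (\<Sum>i\<in>I. \<Sum>j\<in>I. x j * y j)
      - (\<Sum>i\<in>I. \<Sum>j\<in>I. x i * y j) - (\<Sum>i\<in>I. \<Sum>j\<in>I. x j * y i)"
    by (simp add: algebra_simps sum.distrib sum_subtractf)
  also have "(\<Sum>i\<in>I. \<Sum>j\<in>I. x j * y i) = (\<Sum>i\<in>I. \<Sum>j\<in>I. x i * y j)"
    by (rule sum.swap)
  also have "(\<Sum>i\<in>I. \<Sum>j\<in>I. x i * y j) = sum x I * sum y I"
    by (simp add: sum_product)
  also have "(\<Sum>i\<in>I. \<Sum>j\<in>I. x i * y i) = real (card I) * (\<Sum>i\<in>I. x i * y i)"
    by (simp add: sum_distrib_left)
  finally have "(\<Sum>i\<in>I. \<Sum>j\<in>I. (x i - x j) * (y i - y j)) =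
      2 * (real (card I) * (\<Sum>i\<in>I. x i * y i) - sum x I * sum y I)"
    by simp
  moreover have "(\<Sum>i\<in>I. \<Sum>j\<in>I. (x i - x j) * (y i - y j)) \<ge> 0"
    by (intro sum_nonneg assms)
  ultimately show ?thesis by simp
qed

section \<open>The balance between the two sums defining g\<close>

definition numer :: "nat \<Rightarrow> (nat \<Rightarrow> real) \<Rightarrow> real \<Rightarrow> real" where
  "numer d lam \<beta> = (\<Sum>i=1..d. 1 / (1 + \<beta> * lam i))"

definition denom :: "nat \<Rightarrow> (nat \<Rightarrow> real) \<Rightarrow> real \<Rightarrow> real" where
  "denom d lam \<beta> = (\<Sum>i=1..d. lam i / (1 + \<beta> * lam i))"

definition balance :: "nat \<Rightarrow> (nat \<Rightarrow> real) \<Rightarrow> real \<Rightarrow> real" where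
  "balance d lam \<beta> = (\<Sum>i=1..d. (1 - \<beta>\<^sup>2 * lam i) / (1 + \<beta> * lam i))"

lemma g_eq: "g d lam \<beta> = sqrt (numer d lam \<beta> / denom d lam \<beta>)"
  by (simp add: g_def numer_def denom_def)

lemma balance_eq: "balance d lam \<beta> = numer d lam \<beta> - \<beta>\<^sup>2 * denom d lam \<beta>"
  unfolding balance_def numer_def denom_def diff_divide_distrib sum_subtractf sum_distrib_left
    times_divide_eq_right ..

context
  fixes d :: nat and lam :: "nat \<Rightarrow> real"
  assumes d: "d \<ge> 1" and lam_pos: "\<And>i. i \<in> {1..d} \<Longrightarrow> lam i > 0"
begin

lemma factor_pos: "i \<in> {1..d} \<Longrightarrow> \<beta> \<ge> 0 \<Longrightarrow> 1 + \<beta> * lam i > 0"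
  using lam_pos[of i] by (simp add: add_pos_nonneg)

lemma numer_pos: "\<beta> \<ge> 0 \<Longrightarrow> numer d lam \<beta> > 0"
  unfolding numer_def using d factor_pos by (intro sum_pos) auto

lemma denom_pos: "\<beta> \<ge> 0 \<Longrightarrow> denom d lam \<beta> > 0"
  unfolding denom_def using d factor_pos lam_pos by (intro sum_pos) auto

lemma g_pos: "\<beta> \<ge> 0 \<Longrightarrow> g d lam \<beta> > 0"
  by (simp add: g_eq numer_pos denom_pos)

lemma isCont_g:
  assumes "\<beta> > 0"
  shows "isCont (g d lam) \<beta>"
proof -
  have nz: "1 + \<beta> * lam i \<noteq> 0" if "i \<in> {1..d}" for i
    using factor_pos[OF that, of \<beta>] assms by simp
  have "(\<Sum>i=1..d. lam i / (1 + \<beta> * lam i)) \<noteq> 0"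
    using denom_pos[of \<beta>] assms by (simp add: denom_def)
  then have "isCont (\<lambda>\<beta>. sqrt ((\<Sum>i=1..d. 1 / (1 + \<beta> * lam i))
      / (\<Sum>i=1..d. lam i / (1 + \<beta> * lam i)))) \<beta>"
    by (intro continuous_intros) (use nz in auto)
  then show ?thesis by (simp add: g_def[abs_def])
qed

lemma less_g_iff:
  assumes "\<beta> > 0"
  shows "\<beta> < g d lam \<beta> \<longleftrightarrow> balance d lam \<beta> > 0"
proof -
  have "\<beta> < g d lam \<beta> \<longleftrightarrow> sqrt (\<beta>\<^sup>2) < g d lam \<beta>" using assms by simp
  also have "\<dots> \<longleftrightarrow> \<beta>\<^sup>2 < numer d lam \<beta> / denom d lam \<beta>"
    unfolding g_eq by (rule real_sqrt_less_iff)
  also have "\<dots> \<longleftrightarrow> balance d lam \<beta> > 0"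
    using denom_pos[of \<beta>] assms by (simp add: balance_eq pos_less_divide_eq)
  finally show ?thesis .
qed

lemma g_less_iff:
  assumes "\<beta> > 0"
  shows "g d lam \<beta> < \<beta> \<longleftrightarrow> balance d lam \<beta> < 0"
proof -
  have "g d lam \<beta> < \<beta> \<longleftrightarrow> g d lam \<beta> < sqrt (\<beta>\<^sup>2)" using assms by simp
  also have "\<dots> \<longleftrightarrow> numer d lam \<beta> / denom d lam \<beta> < \<beta>\<^sup>2"
    unfolding g_eq by (rule real_sqrt_less_iff)
  also have "\<dots> \<longleftrightarrow> balance d lam \<beta> < 0"
    using denom_pos[of \<beta>] assms by (simp add: balance_eq pos_divide_less_eq)
  finally show ?thesis .
qed

text \<open>
  In each summand the denominator grows while the numerator falls. The numerator may be negative,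
  so the two effects are compared after cross-multiplication: the difference of the two sides is
  \<open>(c - b) l (1 + b + c + b c l)\<close>.
\<close>

lemma balance_strict_decreasing:
  assumes "0 \<le> b" "b < c"
  shows "balance d lam c < balance d lam b"
  unfolding balance_def
proof (rule sum_strict_mono)
  fix i assume i: "i \<in> {1..d}"
  define l where "l = lam i"
  have l: "l > 0" using lam_pos[OF i] by (simp add: l_def)
  have "(1 - b\<^sup>2 * l) * (1 + c * l) - (1 - c\<^sup>2 * l) * (1 + b * l)
      = (c - b) * l * (1 + b + c + b * c * l)"
    by (simp add: power2_eq_square algebra_simps)
  also have "\<dots> > 0"
    using assms l by (intro mult_pos_pos add_pos_nonneg) auto
  finally show "(1 - c\<^sup>2 * lam i) / (1 + c * lam i) < (1 - b\<^sup>2 * lam i) / (1 + b * lam i)"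
    using factor_pos[OF i, of b] factor_pos[OF i, of c] assms
    unfolding l_def by (simp add: frac_less_eq divide_less_0_iff)
qed (use d in auto)

lemma ex_balance_zero:
  obtains p where "p > 0" "balance d lam p = 0"
proof -
  \<comment> \<open>Chosen so that every \<open>b \<lambda>\<^sub>i \<ge> 1\<close> and \<open>b \<ge> 1\<close>, which makes every summand at \<open>b\<close> nonpositive.\<close>
  define b where "b = 1 + (\<Sum>i=1..d. 1 / lam i)"
  have "(\<Sum>i=1..d. 1 / lam i) \<ge> 0"
    by (intro sum_nonneg) (use lam_pos in \<open>auto simp: less_imp_le\<close>)
  then have b1: "b \<ge> 1" by (simp add: b_def)
  have "balance d lam b \<le> 0"
    unfolding balance_def
  proof (rule sum_nonpos)
    fix i assume i: "i \<in> {1..d}"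
    have "1 / lam i \<le> (\<Sum>i=1..d. 1 / lam i)"
      using i lam_pos by (intro member_le_sum) (auto simp: less_imp_le)
    then have "1 / lam i \<le> b" by (simp add: b_def)
    then have "1 \<le> b * lam i" using lam_pos[OF i] by (simp add: field_simps)
    moreover have "b * lam i \<le> b\<^sup>2 * lam i"
      using b1 lam_pos[OF i] by (simp add: power2_eq_square)
    ultimately show "(1 - b\<^sup>2 * lam i) / (1 + b * lam i) \<le> 0"
      using factor_pos[OF i, of b] b1 by (simp add: divide_nonpos_pos)
  qed
  moreover have at0: "balance d lam 0 > 0" using d by (simp add: balance_def)
  moreover have "continuous_on {0..b} (balance d lam)"
  proof -
    have "1 + x * lam i \<noteq> 0" if "x \<in> {0..b}" "i \<in> {1..d}" for x i
      using factor_pos[OF that(2), of x] that(1) by simp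
    then show ?thesis
      unfolding balance_def[abs_def] by (intro continuous_intros) blast
  qed
  moreover have "0 \<le> b" using b1 by simp
  ultimately have "\<exists>p. 0 \<le> p \<and> p \<le> b \<and> balance d lam p = 0"
    by (intro IVT2') (use at0 in auto)
  then obtain p where p: "0 \<le> p" "balance d lam p = 0" by blast
  with at0 have "p > 0" by (cases "p = 0") auto
  with p that show ?thesis by blast
qed

section \<open>Monotonicity of g\<close>

lemma summand_diff_lam:
  fixes b l m :: real
  assumes "1 + b * l \<noteq> 0" "1 + b * m \<noteq> 0"
  shows "l / (1 + b * l) - m / (1 + b * m) = (l - m) / ((1 + b * l) * (1 + b * m))"
proof -
  have "l * (1 + b * m) - m * (1 + b * l) = l - m" by (simp add: algebra_simps)
  then show ?thesis using diff_frac_eq[OF assms, of l m] by metis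
qed

lemma summand_diff_beta:
  fixes b c l :: real
  assumes "1 + b * l \<noteq> 0" "1 + c * l \<noteq> 0"
  shows "l / (1 + b * l) - l / (1 + c * l) = (c - b) * (l / (1 + b * l) * (l / (1 + c * l)))"
proof -
  have "l * (1 + c * l) - l * (1 + b * l) = (c - b) * (l * l)" by (simp add: algebra_simps)
  then show ?thesis
    unfolding diff_frac_eq[OF assms] times_divide_times_eq by simp
qed

lemma numer_add_denom:
  assumes "\<beta> \<ge> 0"
  shows "numer d lam \<beta> + \<beta> * denom d lam \<beta> = real d"
proof -
  have "(1 + \<beta> * lam i) / (1 + \<beta> * lam i) = 1" if "i \<in> {1..d}" for i
    using factor_pos[OF that assms] by simp
  then have "(\<Sum>i=1..d. (1 + \<beta> * lam i) / (1 + \<beta> * lam i)) = (\<Sum>i=1..d. 1)"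
    by (rule sum.cong[OF refl])
  then show ?thesis
    unfolding numer_def denom_def sum_distrib_left times_divide_eq_right
      add_divide_distrib sum.distrib by simp
qed

text \<open>
  By \<open>A + \<beta> B = d\<close> the claim is \<open>d / B(b) - b \<le> d / B(c) - c\<close>, that is,
  \<open>(c - b) B(b) B(c) \<le> d (B(b) - B(c))\<close>. With \<open>x\<^sub>i\<close> and \<open>y\<^sub>i\<close> the summands of \<open>B(b)\<close> and \<open>B(c)\<close>, we have
  \<open>x\<^sub>i - y\<^sub>i = (c - b) x\<^sub>i y\<^sub>i\<close>, so this is Chebyshev's inequality; both families are ordered like
  the \<open>\<lambda>\<^sub>i\<close>.
\<close>

lemma g_mono:
  assumes "0 < b" "b \<le> c"
  shows "g d lam b \<le> g d lam c"
proof -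
  define x where "x i = lam i / (1 + b * lam i)" for i
  define y where "y i = lam i / (1 + c * lam i)" for i
  have fb: "1 + b * lam i > 0" and fc: "1 + c * lam i > 0" if "i \<in> {1..d}" for i
    using factor_pos[OF that] assms by auto
  have x_diff: "x i - x j = (lam i - lam j) / ((1 + b * lam i) * (1 + b * lam j))"
    and y_diff: "y i - y j = (lam i - lam j) / ((1 + c * lam i) * (1 + c * lam j))"
    if "i \<in> {1..d}" "j \<in> {1..d}" for i j
    using fb[OF that(1)] fb[OF that(2)] fc[OF that(1)] fc[OF that(2)]
    unfolding x_def y_def by (intro summand_diff_lam; linarith)+
  have "sum x {1..d} * sum y {1..d} \<le> real (card {1..d}) * (\<Sum>i=1..d. x i * y i)"
  proof (rule Chebyshev_sum_similarly_ordered)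
    fix i j assume ij: "i \<in> {1..d}" "j \<in> {1..d}"
    show "(x i - x j) * (y i - y j) \<ge> 0"
      unfolding x_diff[OF ij] y_diff[OF ij] times_divide_times_eq
      using fb[OF ij(1)] fb[OF ij(2)] fc[OF ij(1)] fc[OF ij(2)]
      by (intro divide_nonneg_nonneg zero_le_square mult_nonneg_nonneg less_imp_le)
  qed
  then have cheb: "denom d lam b * denom d lam c \<le> real d * (\<Sum>i=1..d. x i * y i)"
    by (simp add: denom_def x_def y_def)
  have "x i - y i = (c - b) * (x i * y i)" if "i \<in> {1..d}" for i
    unfolding x_def y_def
    by (rule summand_diff_beta) (use fb[OF that] fc[OF that] in linarith)+
  then have "denom d lam b - denom d lam c = (c - b) * (\<Sum>i=1..d. x i * y i)"
    unfolding denom_def x_def[symmetric] y_def[symmetric] sum_subtractf[symmetric] sum_distrib_left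
    by (rule sum.cong[OF refl])
  then have "real d * (denom d lam b - denom d lam c) =
      (c - b) * (real d * (\<Sum>i=1..d. x i * y i))" by simp
  also have "\<dots> \<ge> (c - b) * (denom d lam b * denom d lam c)"
    using cheb assms by (intro mult_left_mono) auto
  finally have key: "(c - b) * (denom d lam b * denom d lam c)
      \<le> real d * (denom d lam b - denom d lam c)" .
  have nb: "numer d lam b = real d - b * denom d lam b"
    and nc: "numer d lam c = real d - c * denom d lam c"
    using numer_add_denom[of b] numer_add_denom[of c] assms by auto
  have "numer d lam b * denom d lam c \<le> numer d lam c * denom d lam b"
    using key unfolding nb nc by (simp add: algebra_simps)
  then have "numer d lam b / denom d lam b \<le> numer d lam c / denom d lam c"
    using denom_pos[of b] denom_pos[of c] assms
    by (simp add: pos_divide_le_eq pos_le_divide_eq times_divide_eq_left)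
  then show ?thesis unfolding g_eq by (rule real_sqrt_le_mono)
qed

end

section \<open>Global convergence of the iteration\<close>

theorem theorem3:
  fixes d :: nat and lam :: "nat \<Rightarrow> real"
  assumes "d \<ge> 1"
    and "\<And>i. i \<in> {1..d} \<Longrightarrow> lam i > 0"
  shows "g d lam ` {0<..} \<subseteq> {0<..} \<and>
    (\<exists>\<beta>\<^sub>p \<in> {0<..}. g d lam \<beta>\<^sub>p = \<beta>\<^sub>p \<and>
      (\<forall>\<beta> \<in> {0<..}. g d lam \<beta> = \<beta> \<longrightarrow> \<beta> = \<beta>\<^sub>p) \<and>
      (\<forall>\<beta>\<^sub>0 \<in> {0<..}. (\<lambda>n. (g d lam ^^ n) \<beta>\<^sub>0) \<longlonglongrightarrow> \<beta>\<^sub>p))"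
proof -
  obtain p where p: "p > 0" "balance d lam p = 0"
    using ex_balance_zero[of d lam] assms by blast
  have fixed: "g d lam p = p"
    using less_g_iff[of d lam p] g_less_iff[of d lam p] assms p by simp
  have up: "\<beta> < g d lam \<beta>" if "0 < \<beta>" "\<beta> < p" for \<beta>
    using less_g_iff[of d lam \<beta>] balance_strict_decreasing[of d lam \<beta> p] assms p that by simp
  have down: "g d lam \<beta> < \<beta>" if "p < \<beta>" for \<beta>
    using g_less_iff[of d lam \<beta>] balance_strict_decreasing[of d lam p \<beta>] assms p that by simp
  have unique: "\<beta> = p" if "\<beta> > 0" "g d lam \<beta> = \<beta>" for \<beta>
    using up[of \<beta>] down[of \<beta>] that by fastforce
  have limit: "(\<lambda>n. (g d lam ^^ n) \<beta>) \<longlonglongrightarrow> p" if "\<beta> > 0" for \<beta>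
    using isCont_g[OF assms] g_mono[OF assms] p(1) fixed up down that
    by (rule monotone_iteration_tendsto)
  have range: "g d lam ` {0<..} \<subseteq> {0<..}"
    using g_pos[OF assms] by auto
  show ?thesis
  proof (intro conjI bexI[of _ p] ballI impI)
    fix \<beta> :: real assume "\<beta> \<in> {0<..}"
    then have "\<beta> > 0" by simp
    then show "(\<lambda>n. (g d lam ^^ n) \<beta>) \<longlonglongrightarrow> p" by (rule limit)
    assume "g d lam \<beta> = \<beta>"
    with \<open>\<beta> > 0\<close> show "\<beta> = p" by (rule unique)
  next
    show "p \<in> {0<..}" using p(1) by simp
  qed (fact range fixed)+
qed

end
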